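(* Let $k\ge 4$ be an integer. Up to isomorphism, the excluded minors for $\mathcal{P}_{U_{2,4}}^k$ on a ground set $E=\{e,f\}$ of size $2$ are exactly the following five $k$-polymatroids: - $Ex_\alpha^{k-1}$: $\rho(e)=\rho(f)=k-1$ and $\rho(ef)=k-1$; its $k$-dual is $Ex_\beta^{k+1}$. - $Ex_\alpha^{k}$: $\rho(e)=\rho(f)=k-1$ and $\rho(ef)=k$; it is identically self-$k$-dual. - $Ex_\beta^{k}$: $\rho(e)=\rho(f)=k$ and $\rho(ef)=k$; it is identically self-$k$-dual. - $Ex_\beta^{k+1}$: $\rho(e)=\rho(f)=k$ and $\rho(ef)=k+1$; its $k$-dual is $Ex_\alpha^{k-1}$. - $Ex_\epsilon^{k}$: $\rho(e)=k-1$, $\rho(f)=k$ and $\rho(ef)=k$; it is self-$k$-dual. For $k=3$, the excluded minors for $\mathcal{P}_{U_{2,4}}^3$ on a ground set $E=\{e,f\}$ of size $2$ are, up to isomorphism, exactly the following seven $3$-polymatroids: - $Ex_\alpha^{2}$: $\rho(e)=\rho(f)=2$ and $\rho(ef)=2$; its $3$-dual is $Ex_\beta^{4}$. - $Ex_\alpha^{3}$: $\rho(e)=\rho(f)=2$ and $\rho(ef)=3$; it is identically self-$3$-dual. - $Ex_\beta^{3}$: $\rho(e)=\rho(f)=3$ and $\rho(ef)=3$; it is identically self-$3$-dual. - $Ex_\beta^{4}$: $\rho(e)=\rho(f)=3$ and $\rho(ef)=4$; its $3$-dual is $Ex_\alpha^{2}$. - $Ex_\epsilon^{3}$: $\rho(e)=2$,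 $\rho(f)=3$ and $\rho(ef)=3$; it is self-$3$-dual. - $Ex_\gamma^2$: $\rho(e)=1$, $\rho(f)=2$ and $\rho(ef)=2$; its $3$-dual is $Ex_\epsilon^4$. - $Ex_\epsilon^4$: $\rho(e)=2$, $\rho(f)=3$ and $\rho(ef)=4$; its $3$-dual is $Ex_\gamma^2$.
   Context: A polymatroid is a pair $(E,\rho)$ where $E$ is a finite set and $\rho:2^E\to\mathbb{Z}$ satisfies $\rho(\emptyset)=0$, monotonicity and submodularity ($\rho(A)+\rho(B)\ge\rho(A\cap B)+\rho(A\cup B)$). For an integer $k\ge 1$, a $k$-polymatroid is a polymatroid with $\rho(\{e\})\le k$ for all $e\in E$. We write $\rho(e)$, $\rho(ef)$ for $\rho(\{e\})$, $\rho(\{e,f\})$, etc. Two polymatroids are isomorphic if there is a rank-preserving bijection between their ground sets. For $X\subseteq E$, the deletion $\rho\backslash X$ and contraction $\rho/X$ are the polymatroids on $E-X$ given by $(\rho\backslash X)(Y)=\rho(Y)$ and $(\rho/X)(Y)=\rho(X\cup Y)-\rho(X)$. A minor of $\rho$ is a polymatroid $(\rho\backslash X)/Y$ with $X,Y\subseteq E$ disjoint; it is proper if $X\cup Y\ne\emptyset$. The $k$-natural matroid $M_\rho^k$ of a $k$-polymatroid $(E,\rho)$: for each $e\in E$ let $X_e$ be a set of $k$ elements, with $X_e\cap X_f=\emptyset$ for $e\neq f$; for $A\subseteq E$ let $X_A=\bigcup_{e\in A}X_e$. Then $M_\rho^k$ is the matroid on $X_E$ with rank function $r(X)=\min\{\rho(A)+|X-X_A|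 : A\subseteq E\}$. $\mathcal{P}_{U_{2,4}}^k$ denotes the class of $k$-polymatroids whose $k$-natural matroid is binary (representable over $\mathbb{F}_2$). An excluded minor for $\mathcal{P}_{U_{2,4}}^k$ is a $k$-polymatroid that is not in $\mathcal{P}_{U_{2,4}}^k$ but all of whose proper minors are in $\mathcal{P}_{U_{2,4}}^k$. The $k$-dual of a $k$-polymatroid $(E,\rho)$ is the $k$-polymatroid $(E,\rho^* )$ with $\rho^*(X)=k|X|+\rho(E-X)-\rho(E)$. We call $\rho$ self-$k$-dual if $(E,\rho)\cong(E,\rho^* )$, and identically self-$k$-dual if $\rho=\rho^*$. Statements "its $k$-dual is ..." are up to isomorphism. *)

theory Defs
  imports Complex_Main "HOL-Library.Function_Algebras" "HOL-Library.Z2"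
begin

text \<open>
  A polymatroid is a pair of a ground set and a rank function. Only the values of the rank
  function on subsets of the ground set are meaningful, and no notion below depends on the others.
\<close>

type_synonym 'a polymatroid = "'a set \<times> ('a set \<Rightarrow> int)"

abbreviation ground :: "'a polymatroid \<Rightarrow> 'a set" where
  "ground \<equiv> fst"

abbreviation rk :: "'a polymatroid \<Rightarrow> 'a set \<Rightarrow> int" where
  "rk \<equiv> snd"

definition polymatroid :: "'a polymatroid \<Rightarrow> bool" where
  "polymatroid P \<longleftrightarrow>
     finite (ground P) \<and>
     rk P {} = 0 \<and>
     (\<forall>A B. A \<subseteq> B \<and> B \<subseteq> ground P \<longrightarrow> rk P A \<le> rk P B) \<and>
     (\<forall>A B. A \<subseteq> ground P \<and> B \<subseteq> ground P \<longrightarrow>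
        rk P (A \<inter> B) + rk P (A \<union> B) \<le> rk P A + rk P B)"

definition k_polymatroid :: "nat \<Rightarrow> 'a polymatroid \<Rightarrow> bool" where
  "k_polymatroid k P \<longleftrightarrow> polymatroid P \<and> (\<forall>e\<in>ground P. rk P {e} \<le> int k)"

definition poly_iso :: "'a polymatroid \<Rightarrow> 'b polymatroid \<Rightarrow> bool" (infix "\<simeq>" 50) where
  "P \<simeq> Q \<longleftrightarrow>
     (\<exists>h. bij_betw h (ground P) (ground Q) \<and> (\<forall>A. A \<subseteq> ground P \<longrightarrow> rk Q (h ` A) = rk P A))"

definition deletion :: "'a polymatroid \<Rightarrow> 'a set \<Rightarrow> 'a polymatroid" where
  "deletion P X = (ground P - X, rk P)"

definition contraction :: "'a polymatroid \<Rightarrow> 'a set \<Rightarrow> 'a polymatroid" where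
  "contraction P X = (ground P - X, \<lambda>Y. rk P (X \<union> Y) - rk P X)"

definition proper_minor :: "'a polymatroid \<Rightarrow> 'a polymatroid \<Rightarrow> bool" where
  "proper_minor N P \<longleftrightarrow>
     (\<exists>X Y. X \<subseteq> ground P \<and> Y \<subseteq> ground P \<and> X \<inter> Y = {} \<and> X \<union> Y \<noteq> {} \<and>
            N = contraction (deletion P X) Y)"

text \<open>
  The \<open>k\<close>-natural matroid, with \<open>{e} \<times> {..<k}\<close> as the set of \<open>k\<close> elements replacing \<open>e\<close>.
  A matroid is likewise given by its ground set and its rank function.
\<close>

definition natural_matroid :: "nat \<Rightarrow> 'a polymatroid \<Rightarrow> ('a \<times> nat) polymatroid" where
  "natural_matroid k P =
     (ground P \<times> {..<k},
      \<lambda>X. Min {rk P A + int (card (X - A \<times> {..<k})) |A. A \<subseteq> ground P})"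

text \<open>
  A vector of length \<open>n\<close> is a function \<open>nat \<Rightarrow> 'f\<close> that vanishes from \<open>n\<close> on. A representation
  of a matroid assigns to each element a vector (a column of a matrix with \<open>n\<close> rows), such that
  the rank of a set of elements is the dimension of the span of their vectors.
\<close>

definition fun_scale :: "'f::field \<Rightarrow> (nat \<Rightarrow> 'f) \<Rightarrow> nat \<Rightarrow> 'f" where
  "fun_scale c v = (\<lambda>i. c * v i)"

lemma vector_space_fun_scale: "vector_space (fun_scale :: 'f::field \<Rightarrow> _)"
  by (unfold vector_space_def) (auto simp: fun_scale_def fun_eq_iff algebra_simps)

definition representable :: "'f::field itself \<Rightarrow> 'a polymatroid \<Rightarrow> bool" where
  "representable F M \<longleftrightarrow>
     (\<exists>n (v :: 'a \<Rightarrow> nat \<Rightarrow> 'f).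
        (\<forall>x\<in>ground M. \<forall>i\<ge>n. v x i = 0) \<and>
        (\<forall>X. X \<subseteq> ground M \<longrightarrow> rk M X = int (vector_space.dim fun_scale (v ` X))))"

definition binary :: "'a polymatroid \<Rightarrow> bool" where
  "binary M \<longleftrightarrow> representable TYPE(bit) M"

text \<open>Membership in \<open>\<P>\<close> with superscript \<open>k\<close> and subscript \<open>U\<^sub>2\<^sub>,\<^sub>4\<close>.\<close>

definition in_P_U24 :: "nat \<Rightarrow> 'a polymatroid \<Rightarrow> bool" where
  "in_P_U24 k P \<longleftrightarrow> k_polymatroid k P \<and> binary (natural_matroid k P)"

definition excluded_minor :: "nat \<Rightarrow> 'a polymatroid \<Rightarrow> bool" where
  "excluded_minor k P \<longleftrightarrow>
     k_polymatroid k P \<and> \<not> in_P_U24 k P \<and> (\<forall>N. proper_minor N P \<longrightarrow> in_P_U24 k N)"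

definition k_dual :: "nat \<Rightarrow> 'a polymatroid \<Rightarrow> 'a polymatroid" where
  "k_dual k P =
     (ground P, \<lambda>X. int k * int (card X) + rk P (ground P - X) - rk P (ground P))"

definition self_k_dual :: "nat \<Rightarrow> 'a polymatroid \<Rightarrow> bool" where
  "self_k_dual k P \<longleftrightarrow> P \<simeq> k_dual k P"

definition identically_self_k_dual :: "nat \<Rightarrow> 'a polymatroid \<Rightarrow> bool" where
  "identically_self_k_dual k P \<longleftrightarrow> (\<forall>X. X \<subseteq> ground P \<longrightarrow> rk P X = rk (k_dual k P) X)"

definition poly2 :: "'a \<Rightarrow> 'a \<Rightarrow> int \<Rightarrow> int \<Rightarrow> int \<Rightarrow> 'a polymatroid" where
  "poly2 e f a b c =
     ({e, f}, \<lambda>A. if A = {} then 0 else if A = {e} then a else if A = {f} then b else c)"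

text \<open>The parameter \<open>n\<close> (a superscript in the usual notation) is the rank of \<open>{e, f}\<close>.\<close>

definition Ex_alpha :: "nat \<Rightarrow> int \<Rightarrow> 'a \<Rightarrow> 'a \<Rightarrow> 'a polymatroid" where
  "Ex_alpha k n e f = poly2 e f (int k - 1) (int k - 1) n"

definition Ex_beta :: "nat \<Rightarrow> int \<Rightarrow> 'a \<Rightarrow> 'a \<Rightarrow> 'a polymatroid" where
  "Ex_beta k n e f = poly2 e f (int k) (int k) n"

definition Ex_epsilon :: "nat \<Rightarrow> int \<Rightarrow> 'a \<Rightarrow> 'a \<Rightarrow> 'a polymatroid" where
  "Ex_epsilon k n e f = poly2 e f (int k - 1) (int k) n"

text \<open>Used for \<open>k = 3\<close> only.\<close>

definition Ex_gamma :: "int \<Rightarrow> 'a \<Rightarrow> 'a \<Rightarrow> 'a polymatroid" where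
  "Ex_gamma n e f = poly2 e f 1 2 n"

text \<open>
  Up to isomorphism, the members of the class \<open>C\<close> are exactly the polymatroids in the list:
  the list consists of members, meets every isomorphism class of members, and has no repetitions
  up to isomorphism.
\<close>

definition exactly_up_to_iso ::
    "('a polymatroid \<Rightarrow> bool) \<Rightarrow> 'a polymatroid list \<Rightarrow> bool" where
  "exactly_up_to_iso C L \<longleftrightarrow>
     (\<forall>Q\<in>set L. C Q) \<and>
     (\<forall>P. C P \<longrightarrow> (\<exists>Q\<in>set L. P \<simeq> Q)) \<and>
     (\<forall>i<length L. \<forall>j<length L. i \<noteq> j \<longrightarrow> \<not> L ! i \<simeq> L ! j)"

end

theory Submission
  imports Defs
begin

text \<open>
  A set in the natural matroid of a polymatroid on \<open>{x, y}\<close> with \<open>\<rho>(x) = a\<close>, \<open>\<rho>(y) = b\<close> and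
  \<open>\<rho>(xy) = c\<close> has rank \<open>min {p + q, a + q, b + p, c}\<close>, where \<open>p\<close> and \<open>q\<close> count its elements above \<open>x\<close>
  and above \<open>y\<close>. So the whole question is about three integers.

  The proper minors that matter have one element. Their natural matroids are uniform, on \<open>k\<close> elements and
  of rank \<open>a\<close>, \<open>b\<close>, \<open>c - a\<close> or \<open>c - b\<close>. Such a matroid is binary exactly if its rank is \<open>0\<close>, \<open>1\<close>, \<open>k - 1\<close>
  or \<open>k\<close> (\<open>binary_uniform_iff\<close>): otherwise it has a minor \<open>U\<^sub>2\<^sub>,\<^sub>4\<close>, and in these cases it consists of
  loops, one parallel class, one circuit, or coloops. With \<open>a \<le> b\<close>, the four conditions are so strong that only
  finitely many shapes of \<open>(a, b, c)\<close> survive (\<open>minor_ranks_cases\<close>): the triples of the theorem, the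
  direct sums \<open>c = a + b\<close>, and \<open>(1, 1, 1)\<close>, \<open>(1, k, k)\<close> and \<open>(k, k, 2 k - 1)\<close>.

  Each of the last four shapes is binary. Up to direct sums, its natural matroid is the pullback of a circuit,
  and the circuit on \<open>m + 1\<close> elements is represented over every field by \<open>m\<close> unit vectors and their
  sum (\<open>representable_circuit_image\<close>, \<open>representable_direct_sum\<close>). Each triple of the theorem is not binary,
  because a suitable contraction leaves \<open>U\<^sub>2\<^sub>,\<^sub>4\<close> (\<open>not_binary_if_excluded_triple\<close>): a line over the two-element
  field has only three points (\<open>not_binary_if_four_point_line\<close>).

  Two-element polymatroids are isomorphic exactly if their triples agree once the smaller singleton rank is
  put first, which yields the lists of isomorphism classes. The \<open>k\<close>-dual of \<open>(a, b, c)\<close> is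
  \<open>(k + b - c, k + a - c, 2 k - c)\<close>, from which the statements on duals are read off.
\<close>

section \<open>Representations\<close>

text \<open>
  Finiteness of \<open>S\<close> replaces finite dimension, which the space of all functions
  \<open>nat \<Rightarrow> 'f\<close> does not have. With this lemma, every rank computation below is an induction that adds one
  element at a time and only asks whether a vector lies in a span.
\<close>

lemma (in vector_space) dim_insert_finite:
  assumes "finite S"
  shows "dim (insert x S) = (if x \<in> span S then dim S else dim S + 1)"
proof -
  obtain B where B: "B \<subseteq> S" "independent B" "S \<subseteq> span B"
    using maximal_independent_subset[of S] by blast
  have fB: "finite B" and spB: "span B = span S"
    using B assms finite_subset by (auto simp: span_eq intro: span_superset span_mono span_base)
  have dS: "dim S = card B"
    using dim_eq_card[OF spB B(2)] .
  show ?thesis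
  proof (cases "x \<in> span S")
    case True
    then show ?thesis using span_eq_dim[OF span_redundant[OF True]] by simp
  next
    case False
    have "independent (insert x B)" "x \<notin> B"
      using False B independent_insertI span_base by (auto simp: spB)
    moreover have "span (insert x B) = span (insert x S)"
      using spB by (simp add: span_insert)
    ultimately show ?thesis
      using False dim_eq_card[of "insert x B" "insert x S"] dS fB by simp
  qed
qed

text \<open>
  Modulo the span of \<open>S\<close>, the vector \<open>w\<close> is a combination of \<open>u\<close> and \<open>v\<close> in which both coefficients
  are nonzero. Over the two-element field both are therefore one, so that \<open>u\<close> and \<open>v\<close> determine \<open>w\<close>
  modulo the span of \<open>S\<close>.
\<close>

lemma (in vector_space) diff_in_span_if_circuit:
  assumes two: "\<And>c::'a. c = 0 \<or> c = 1"
    and "w \<in> span (insert u (insert v S))"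
    and "w \<notin> span (insert u S)" "w \<notin> span (insert v S)"
  shows "w - (u + v) \<in> span S"
proof -
  obtain c d where cd: "w - scale c u - scale d v \<in> span S"
    using assms(2) by (auto simp: span_breakdown_eq)
  have "c \<noteq> 0" using cd assms(4) by (auto simp: span_breakdown_eq)
  moreover have "d \<noteq> 0" using cd assms(3) by (auto simp: span_breakdown_eq)
  ultimately show ?thesis using cd two[of c] two[of d] by (auto simp: algebra_simps)
qed

text \<open>
  The only third point on the line through \<open>u\<close> and \<open>v\<close> is \<open>u + v\<close>, hence \<open>w\<close> and \<open>z\<close>
  agree modulo the span of \<open>S\<close>. This is why \<open>U\<^sub>2\<^sub>,\<^sub>4\<close> is not binary.
\<close>

lemma (in vector_space) no_four_point_line:
  assumes two: "\<And>c::'a. c = 0 \<or> c = 1"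
    and w: "w \<in> span (insert u (insert v S))" "w \<notin> span (insert u S)" "w \<notin> span (insert v S)"
    and z: "z \<in> span (insert u (insert v S))" "z \<notin> span (insert u S)" "z \<notin> span (insert v S)"
  shows "w \<in> span (insert z S)"
proof -
  have "(w - (u + v)) - (z - (u + v)) \<in> span S"
    using diff_in_span_if_circuit[OF two w] diff_in_span_if_circuit[OF two z] by (rule span_diff)
  then have "w - scale 1 z \<in> span S" by simp
  then show ?thesis by (auto simp only: span_breakdown_eq)
qed

interpretation fs: vector_space "fun_scale :: 'f::field \<Rightarrow> (nat \<Rightarrow> 'f) \<Rightarrow> nat \<Rightarrow> 'f"
  by (rule vector_space_fun_scale)

text \<open>
  The hypothesis on ranks says that contracting \<open>C\<close> and restricting to \<open>T\<close> gives \<open>U\<^sub>2\<^sub>,\<^sub>4\<close>. It is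
  stated without minors, since a rank increment directly decides membership in a span. This is
  the easy half of Tutte's theorem on binary matroids, and the tool for every negative result below.
\<close>

lemma not_binary_if_four_point_line:
  assumes "C \<subseteq> ground M" "T \<subseteq> ground M" "finite C" "card T = 4"
    and rk: "\<And>D. D \<subseteq> T \<Longrightarrow> rk M (C \<union> D) = R + int (min (card D) 2)"
  shows "\<not> binary M"
proof
  assume "binary M"
  then obtain n and v :: "'a \<Rightarrow> nat \<Rightarrow> bit" where
    v: "\<And>X. X \<subseteq> ground M \<Longrightarrow> rk M X = int (fs.dim (v ` X))"
    unfolding binary_def representable_def by blast
  obtain x1 x2 x3 x4 where T: "T = {x1, x2, x3, x4}" and ne: "distinct [x1, x2, x3, x4]"
    using assms(4) by (auto simp: card_Suc_eq numeral_eq_Suc)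
  have dim: "int (fs.dim (v ` (C \<union> D))) = R + int (min (card D) 2)" if "D \<subseteq> T" for D
    using rk[OF that] v[of "C \<union> D"] that assms(1,2) by auto
  have fin: "finite (v ` (C \<union> D))" if "D \<subseteq> T" for D
    using that assms(3,4) finite_subset card.infinite by fastforce
  have mem: "v x \<in> fs.span (v ` (C \<union> D)) \<longleftrightarrow> 2 \<le> card D"
    if D: "D \<subseteq> T" and x: "x \<in> T - D" for x D
  proof -
    have fD: "finite D" using D T finite_subset by auto
    have "fs.dim (insert (v x) (v ` (C \<union> D)))
        = (if v x \<in> fs.span (v ` (C \<union> D)) then fs.dim (v ` (C \<union> D)) else fs.dim (v ` (C \<union> D)) + 1)"
      using fs.dim_insert_finite[OF fin[OF D]] .
    moreover have "int (fs.dim (insert (v x) (v ` (C \<union> D)))) = R + int (min (card D + 1) 2)"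
      using dim[of "insert x D"] x D fD by simp
    ultimately show ?thesis using dim[OF D] by (auto split: if_splits)
  qed
  have two: "c = 0 \<or> c = 1" for c :: bit by auto
  have "v x3 \<in> fs.span (insert (v x4) (v ` C))"
    using mem[of "{x1,x2}" x3] mem[of "{x1}" x3] mem[of "{x2}" x3]
      mem[of "{x1,x2}" x4] mem[of "{x1}" x4] mem[of "{x2}" x4] ne T
    by (intro fs.no_four_point_line[OF two, of "v x3" "v x1" "v x2" "v ` C" "v x4"]) auto
  then show False using mem[of "{x4}" x3] ne T by auto
qed

text \<open>
  The map \<open>\<phi>\<close> may identify elements, so this covers restrictions as well as parallel extensions.
\<close>

lemma representable_pullback:
  fixes F :: "'f::field itself" and M :: "'a polymatroid" and N :: "'b polymatroid"
  assumes "representable F N" "\<phi> ` ground M \<subseteq> ground N"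
    and "\<And>X. X \<subseteq> ground M \<Longrightarrow> rk M X = rk N (\<phi> ` X)"
  shows "representable F M"
proof -
  obtain n and v :: "'b \<Rightarrow> nat \<Rightarrow> 'f" where
    v: "\<And>x i. x \<in> ground N \<Longrightarrow> i \<ge> n \<Longrightarrow> v x i = 0"
      "\<And>X. X \<subseteq> ground N \<Longrightarrow> rk N X = int (fs.dim (v ` X))"
    using assms(1) unfolding representable_def by blast
  show ?thesis unfolding representable_def
  proof (intro exI[of _ n] exI[of _ "v \<circ> \<phi>"] conjI allI impI ballI)
    fix X assume "X \<subseteq> ground M"
    then show "rk M X = int (fs.dim ((v \<circ> \<phi>) ` X))"
      using assms(2,3) v(2)[of "\<phi> ` X"] by (auto simp: image_comp)
  qed (use v(1) assms(2) in auto)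
qed

text \<open>
  Truncating a vector, shifting it forward and shifting it backward are all of this form, so that
  their linearity is needed only once.
\<close>

definition reindex :: "(nat \<Rightarrow> bool) \<Rightarrow> (nat \<Rightarrow> nat) \<Rightarrow> (nat \<Rightarrow> 'f::field) \<Rightarrow> nat \<Rightarrow> 'f" where
  "reindex J g v = (\<lambda>i. if J i then v (g i) else 0)"

lemma reindex_in_span:
  assumes "w \<in> fs.span V"
  shows "reindex J g w \<in> fs.span (reindex J g ` V)"
  using assms
proof (induction rule: fs.span_induct_alt)
  case base
  have "reindex J g 0 = 0" by (auto simp: reindex_def fun_eq_iff)
  then show ?case by (metis fs.span_zero)
next
  case (step c x y)
  have "reindex J g (fun_scale c x + y) = fun_scale c (reindex J g x) + reindex J g y"
    by (auto simp: reindex_def fun_eq_iff fun_scale_def)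
  moreover have "fun_scale c (reindex J g x) + reindex J g y \<in> fs.span (reindex J g ` V)"
    by (rule fs.span_add[OF fs.span_scale[OF fs.span_base] step.IH]) (use step.hyps in blast)
  ultimately show ?case by metis
qed

text \<open>
  Give \<open>M\<close> the first \<open>m\<close> coordinates and shift the vectors of \<open>N\<close> behind them. An element of \<open>M\<close>
  is then spanned by a set exactly if it is spanned by the part of that set in \<open>M\<close>: apply the
  projection to the first \<open>m\<close> coordinates, which kills the vectors of \<open>N\<close>. The same holds for \<open>N\<close>.
\<close>

lemma representable_direct_sum:
  fixes F :: "'f::field itself" and M N S :: "'a polymatroid"
  assumes "representable F M" "representable F N"
    and G: "ground S = ground M \<union> ground N" "ground M \<inter> ground N = {}" "finite (ground S)"
    and rk: "\<And>X. X \<subseteq> ground S \<Longrightarrow> rk S X = rk M (X \<inter> ground M) + rk N (X \<inter> ground N)"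
  shows "representable F S"
proof -
  obtain m and v :: "'a \<Rightarrow> nat \<Rightarrow> 'f" where
    v: "\<And>x i. x \<in> ground M \<Longrightarrow> i \<ge> m \<Longrightarrow> v x i = 0"
      "\<And>X. X \<subseteq> ground M \<Longrightarrow> rk M X = int (fs.dim (v ` X))"
    using assms(1) unfolding representable_def by blast
  obtain n and w :: "'a \<Rightarrow> nat \<Rightarrow> 'f" where
    w: "\<And>x i. x \<in> ground N \<Longrightarrow> i \<ge> n \<Longrightarrow> w x i = 0"
      "\<And>X. X \<subseteq> ground N \<Longrightarrow> rk N X = int (fs.dim (w ` X))"
    using assms(2) unfolding representable_def by blast
  define head :: "(nat \<Rightarrow> 'f) \<Rightarrow> nat \<Rightarrow> 'f" where "head = reindex (\<lambda>i. i < m) id"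
  define tail :: "(nat \<Rightarrow> 'f) \<Rightarrow> nat \<Rightarrow> 'f" where "tail = reindex (\<lambda>_. True) (\<lambda>i. i + m)"
  define shift :: "(nat \<Rightarrow> 'f) \<Rightarrow> nat \<Rightarrow> 'f" where "shift = reindex (\<lambda>i. m \<le> i) (\<lambda>i. i - m)"
  define u where "u = (\<lambda>x. if x \<in> ground M then v x else shift (w x))"
  have uM: "u x = v x" "head (u x) = v x" "tail (u x) = 0" if "x \<in> ground M" for x
    using that v(1) by (auto simp: u_def head_def tail_def reindex_def fun_eq_iff)
  have uN: "u x = shift (w x)" "head (u x) = 0" "tail (u x) = w x" if "x \<in> ground N" for x
  proof -
    have "x \<notin> ground M" using that G(2) by auto
    then show "u x = shift (w x)" "head (u x) = 0" "tail (u x) = w x"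
      by (auto simp: u_def head_def tail_def shift_def reindex_def fun_eq_iff)
  qed
  have dim: "fs.dim (u ` X) = fs.dim (v ` (X \<inter> ground M)) + fs.dim (w ` (X \<inter> ground N))"
    if "X \<subseteq> ground S" for X
  proof -
    have "finite X" using that G(3) finite_subset by blast
    then show ?thesis using that
    proof (induction X rule: finite_induct)
      case empty
      show ?case using fs.dim_le_card'[of "{}"] fs.dim_le_card'[of "{}"] by simp
    next
      case (insert x X)
      define A where "A = X \<inter> ground M"
      define B where "B = X \<inter> ground N"
      have X: "X = A \<union> B" using insert.prems G(1) by (auto simp: A_def B_def)
      have AB: "A \<subseteq> ground M" "B \<subseteq> ground N" by (auto simp: A_def B_def)
      have fin: "finite (u ` X)" "finite (v ` A)" "finite (w ` B)"
        using insert.hyps by (auto simp: A_def B_def)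
      have IH: "fs.dim (u ` X) = fs.dim (v ` A) + fs.dim (w ` B)"
        using insert by (auto simp: A_def B_def)
      have uA: "u ` A = v ` A" and uB: "u ` B = shift ` w ` B"
        using AB uM uN by (auto simp: subset_iff image_iff)+
      have ins0: "fs.span V \<subseteq> fs.span W" if "V \<subseteq> insert 0 W" for V W :: "(nat \<Rightarrow> 'f) set"
        using fs.span_mono[OF that] by simp
      show ?case
      proof (cases "x \<in> ground M")
        case True
        then have xN: "x \<notin> ground N" using G(2) by auto
        have "u x \<in> fs.span (u ` X) \<longleftrightarrow> v x \<in> fs.span (v ` A)"
        proof
          assume "u x \<in> fs.span (u ` X)"
          then have "head (u x) \<in> fs.span (head ` u ` X)"
            unfolding head_def by (rule reindex_in_span)
          moreover have "head ` u ` X \<subseteq> insert 0 (v ` A)"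
            using uM uN AB by (auto simp: X subset_iff)
          ultimately show "v x \<in> fs.span (v ` A)" by (metis ins0 subsetD uM(2) True)
        next
          assume "v x \<in> fs.span (v ` A)"
          then show "u x \<in> fs.span (u ` X)"
            using fs.span_mono[of "v ` A" "u ` X"] uA uM(1)[OF True] by (auto simp: X image_Un)
        qed
        then show ?thesis
          using True xN IH fs.dim_insert_finite[OF fin(1), of "u x"]
            fs.dim_insert_finite[OF fin(2), of "v x"]
          by (simp add: A_def[symmetric] B_def[symmetric])
      next
        case False
        then have xN: "x \<in> ground N" using insert.prems G(1) by auto
        have "u x \<in> fs.span (u ` X) \<longleftrightarrow> w x \<in> fs.span (w ` B)"
        proof
          assume "u x \<in> fs.span (u ` X)"
          then have "tail (u x) \<in> fs.span (tail ` u ` X)"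
            unfolding tail_def by (rule reindex_in_span)
          moreover have "tail ` u ` X \<subseteq> insert 0 (w ` B)"
            using uM uN AB by (auto simp: X subset_iff)
          ultimately show "w x \<in> fs.span (w ` B)" by (metis ins0 subsetD uN(3) xN)
        next
          assume "w x \<in> fs.span (w ` B)"
          then have "shift (w x) \<in> fs.span (shift ` w ` B)"
            unfolding shift_def by (rule reindex_in_span)
          then show "u x \<in> fs.span (u ` X)"
            using fs.span_mono[of "u ` B" "u ` X"] uB uN(1)[OF xN] by (auto simp: X image_Un)
        qed
        then show ?thesis
          using False xN IH fs.dim_insert_finite[OF fin(1), of "u x"]
            fs.dim_insert_finite[OF fin(3), of "w x"]
          by (simp add: A_def[symmetric] B_def[symmetric])
      qed
    qed
  qed
  show ?thesis unfolding representable_def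
  proof (intro exI[of _ "m + n"] exI[of _ u] conjI allI impI ballI)
    fix x i assume "x \<in> ground S" "m + n \<le> i"
    then show "u x i = 0" using v(1)[of x i] w(1)[of x "i - m"] G(1)
      by (auto simp: u_def shift_def reindex_def)
  next
    fix X assume X: "X \<subseteq> ground S"
    show "rk S X = int (fs.dim (u ` X))" using rk[OF X] v(2) w(2) dim[OF X] by simp
  qed
qed

section \<open>Uniform matroids\<close>

definition uniform_matroid :: "nat \<Rightarrow> 'a set \<Rightarrow> 'a polymatroid" where
  "uniform_matroid r S = (S, \<lambda>X. int (min (card X) r))"

text \<open>
  The circuit on \<open>m + 1\<close> elements is represented by the \<open>m\<close> unit vectors and their sum.
  A coordinate missing from a set of unit vectors vanishes on its span, so the sum is spanned
  by all \<open>m\<close> unit vectors and by no smaller set of them.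
\<close>

lemma representable_circuit:
  "representable F (uniform_matroid m {..m})" for F :: "'f::field itself"
proof -
  define unit :: "nat \<Rightarrow> nat \<Rightarrow> 'f" where "unit = (\<lambda>i j. if j = i then 1 else 0)"
  define ones :: "nat \<Rightarrow> nat \<Rightarrow> 'f" where "ones = (\<lambda>l j. if j < l then 1 else 0)"
  define v where "v = (\<lambda>i. if i = m then ones m else unit i)"
  have zero: "w j = 0" if "w \<in> fs.span (unit ` X)" "j \<notin> X" for w j X
  proof -
    have "fs.subspace {w :: nat \<Rightarrow> 'f. w j = 0}"
      by (rule fs.subspaceI) (auto simp: fun_scale_def)
    moreover have "unit ` X \<subseteq> {w. w j = 0}" using that(2) by (auto simp: unit_def)
    ultimately have "fs.span (unit ` X) \<subseteq> {w. w j = 0}" by (intro fs.span_minimal)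
    then show ?thesis using that(1) by auto
  qed
  have ones: "ones l \<in> fs.span (unit ` {..<l})" for l
  proof (induction l)
    case 0
    have "ones 0 = 0" by (auto simp: ones_def fun_eq_iff)
    then show ?case by (metis fs.span_zero)
  next
    case (Suc l)
    have "ones (Suc l) = ones l + unit l"
      by (auto simp: ones_def unit_def fun_eq_iff)
    moreover have "ones l \<in> fs.span (unit ` {..<Suc l})"
      using Suc fs.span_mono[of "unit ` {..<l}" "unit ` {..<Suc l}"] by (auto simp: lessThan_Suc)
    moreover have "unit l \<in> fs.span (unit ` {..<Suc l})"
      by (intro fs.span_base) auto
    ultimately show ?case by (metis fs.span_add)
  qed
  have dim_unit: "fs.dim (unit ` X) = card X" if "finite X" for X
    using that
  proof (induction X rule: finite_induct)
    case empty
    show ?case using fs.dim_le_card'[of "{}"] by simp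
  next
    case (insert x X)
    have "unit x \<notin> fs.span (unit ` X)" using zero[of "unit x" X x] insert by (auto simp: unit_def)
    then show ?case using insert fs.dim_insert_finite[of "unit ` X" "unit x"] by simp
  qed
  have dim: "fs.dim (v ` X) = min (card X) m" if X: "X \<subseteq> {..m}" for X
  proof -
    define Y where "Y = X - {m}"
    have Y: "Y \<subseteq> {..<m}" using X by (force simp: Y_def)
    then have fY: "finite Y" and cY: "card Y \<le> m"
      using finite_subset card_mono[of "{..<m}" Y] by auto
    have vY: "v ` Y = unit ` Y" by (auto simp: v_def Y_def)
    show ?thesis
    proof (cases "m \<in> X")
      case False
      then show ?thesis using dim_unit[OF fY] vY cY by (simp add: Y_def)
    next
      case True
      then have XY: "X = insert m Y" "m \<notin> Y" by (auto simp: Y_def)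
      have iff: "ones m \<in> fs.span (unit ` Y) \<longleftrightarrow> card Y = m"
      proof
        assume *: "ones m \<in> fs.span (unit ` Y)"
        have "{..<m} \<subseteq> Y" using zero[OF *] by (force simp: ones_def)
        then show "card Y = m" using Y by (metis card_lessThan subset_antisym)
      next
        assume "card Y = m"
        then have "Y = {..<m}" using Y by (simp add: card_subset_eq)
        then show "ones m \<in> fs.span (unit ` Y)" using ones by simp
      qed
      have "v ` X = insert (ones m) (unit ` Y)"
        using vY XY by (simp add: v_def)
      then show ?thesis
        using fs.dim_insert_finite[of "unit ` Y" "ones m"] iff dim_unit[OF fY] fY XY cY by auto
    qed
  qed
  show ?thesis unfolding representable_def
  proof (intro exI[of _ m] exI[of _ v] conjI allI impI ballI)
    fix x i assume "x \<in> ground (uniform_matroid m {..m})" "m \<le> i"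
    then show "v x i = 0" by (auto simp: v_def unit_def ones_def uniform_matroid_def)
  next
    fix X assume "X \<subseteq> ground (uniform_matroid m {..m})"
    then show "rk (uniform_matroid m {..m}) X = int (fs.dim (v ` X))"
      using dim[of X] by (simp add: uniform_matroid_def)
  qed
qed

text \<open>
  Loops, parallel classes, free matroids and circuits, and circuits with an element replaced by a
  parallel class, all arise from a circuit in this way. So this is the source of
  all representations that are not direct sums.
\<close>

lemma representable_circuit_image:
  fixes \<phi> :: "'a \<Rightarrow> nat"
  assumes "\<phi> ` ground M \<subseteq> {..m}"
    and "\<And>X. X \<subseteq> ground M \<Longrightarrow> rk M X = int (min (card (\<phi> ` X)) m)"
  shows "representable F M"
  by (rule representable_pullback[OF representable_circuit, of \<phi> _ m])
    (use assms in \<open>auto simp: uniform_matroid_def\<close>)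

lemma representable_uniform:
  assumes "finite S" "r = 0 \<or> r = 1 \<or> card S \<le> r + 1"
  shows "representable F (uniform_matroid r S)"
proof (cases "r \<le> 1")
  case True
  have "min (card X) r = min (card ((\<lambda>_. 0::nat) ` X)) r" if "X \<subseteq> S" for X
  proof -
    have "finite X" using that assms(1) finite_subset by blast
    then have "card X = 0 \<longleftrightarrow> X = {}" by simp
    then show ?thesis using True by (cases "X = {}") (auto simp: le_Suc_eq image_constant_conv)
  qed
  then show ?thesis
    by (intro representable_circuit_image[of "\<lambda>_. 0" _ r]) (auto simp: uniform_matroid_def)
next
  case False
  obtain g :: "'a \<Rightarrow> nat" where g: "bij_betw g S {0..<card S}"
    using ex_bij_betw_finite_nat[OF assms(1)] by blast
  show ?thesis
  proof (rule representable_circuit_image[of g _ r])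
    show "g ` ground (uniform_matroid r S) \<subseteq> {..r}"
      using g assms(2) False by (auto simp: uniform_matroid_def bij_betw_def)
    fix X assume "X \<subseteq> ground (uniform_matroid r S)"
    then have "card (g ` X) = card X"
      using g by (auto simp: uniform_matroid_def bij_betw_def intro: card_image inj_on_subset)
    then show "rk (uniform_matroid r S) X = int (min (card (g ` X)) r)"
      by (simp add: uniform_matroid_def)
  qed
qed

text \<open>
  Contracting \<open>r - 2\<close> elements leaves a uniform matroid of rank two on at least four elements.
\<close>

lemma not_binary_uniform:
  assumes "2 \<le> r" "r + 2 \<le> card S"
  shows "\<not> binary (uniform_matroid r S)"
proof -
  obtain A where A: "A \<subseteq> S" "card A = r + 2" "finite A"
    using obtain_subset_with_card_n[OF assms(2)] .
  obtain T where T: "T \<subseteq> A" "card T = 4" "finite T"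
    using obtain_subset_with_card_n[of 4 A] A assms(1) by auto
  show ?thesis
  proof (rule not_binary_if_four_point_line[of "A - T" _ T "int r - 2"])
    fix D assume "D \<subseteq> T"
    then have "card ((A - T) \<union> D) = card (A - T) + card D"
      using A T finite_subset by (intro card_Un_disjoint) auto
    also have "card (A - T) = r - 2" using A T by (simp add: card_Diff_subset)
    finally show "rk (uniform_matroid r S) (A - T \<union> D) = int r - 2 + int (min (card D) 2)"
      using assms(1) by (auto simp: uniform_matroid_def)
  qed (use A T in \<open>auto simp: uniform_matroid_def\<close>)
qed

lemma binary_uniform_iff:
  assumes "finite S"
  shows "binary (uniform_matroid r S) \<longleftrightarrow> r = 0 \<or> r = 1 \<or> card S \<le> r + 1"
  using representable_uniform[OF assms, of r "TYPE(bit)"] not_binary_uniform[of r S]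
  unfolding binary_def by linarith

section \<open>Polymatroids on at most one element\<close>

lemma binary_cong:
  assumes "ground M = ground N" "\<And>X. X \<subseteq> ground M \<Longrightarrow> rk M X = rk N X"
  shows "binary M \<longleftrightarrow> binary N"
  using representable_pullback[of "TYPE(bit)" N id M] representable_pullback[of "TYPE(bit)" M id N] assms
  by (auto simp: binary_def)

lemma ground_natural_matroid [simp]: "ground (natural_matroid k P) = ground P \<times> {..<k}"
  by (simp add: natural_matroid_def)

lemma rk_natural_matroid_Pow:
  "rk (natural_matroid k P) X = Min ((\<lambda>A. rk P A + int (card (X - A \<times> {..<k}))) ` Pow (ground P))"
  by (simp add: natural_matroid_def setcompr_eq_image Pow_def)

lemma in_P_U24_empty:
  assumes "ground P = {}" "rk P {} = 0"
  shows "in_P_U24 k P"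
proof -
  have "binary (natural_matroid k P)"
    unfolding binary_def
    by (rule representable_circuit_image[of "\<lambda>_. 0" _ 0]) (auto simp: natural_matroid_def assms)
  then show ?thesis
    using assms by (auto simp: in_P_U24_def k_polymatroid_def polymatroid_def)
qed

text \<open>
  The ranks \<open>a\<close> for which the uniform matroid of rank \<open>a\<close> on \<open>k\<close> elements is binary.
\<close>

definition binary_rank :: "nat \<Rightarrow> int \<Rightarrow> bool" where
  "binary_rank k a \<longleftrightarrow> a \<in> {0, 1, int k - 1, int k}"

text \<open>
  The natural matroid of a one-element polymatroid of rank \<open>a\<close> is uniform of rank \<open>a\<close> on \<open>k\<close> elements.
\<close>

lemma in_P_U24_singleton_iff:
  assumes P: "ground P = {x}" and k: "1 \<le> k"
  shows "in_P_U24 k P \<longleftrightarrow> rk P {} = 0 \<and> binary_rank k (rk P {x})"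
proof -
  have poly: "k_polymatroid k P \<longleftrightarrow> rk P {} = 0 \<and> 0 \<le> rk P {x} \<and> rk P {x} \<le> int k"
  proof
    assume L: "k_polymatroid k P"
    then have "rk P {} \<le> rk P {x}"
      unfolding k_polymatroid_def polymatroid_def P by blast
    then show "rk P {} = 0 \<and> 0 \<le> rk P {x} \<and> rk P {x} \<le> int k"
      using L by (simp add: k_polymatroid_def polymatroid_def P)
  next
    assume R: "rk P {} = 0 \<and> 0 \<le> rk P {x} \<and> rk P {x} \<le> int k"
    have A: "A = {} \<or> A = {x}" if "A \<subseteq> {x}" for A using that by blast
    have "rk P A \<le> rk P B" if "A \<subseteq> B" "B \<subseteq> {x}" for A B
      using A[OF subset_trans[OF that]] A[OF that(2)] that R by (elim disjE) simp_all
    moreover have "rk P (A \<inter> B) + rk P (A \<union> B) \<le> rk P A + rk P B"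
      if "A \<subseteq> {x}" "B \<subseteq> {x}" for A B
      using A[OF that(1)] A[OF that(2)] R by (elim disjE) simp_all
    ultimately show "k_polymatroid k P"
      using R by (simp add: k_polymatroid_def polymatroid_def P)
  qed
  have "binary (natural_matroid k P) \<longleftrightarrow> binary_rank k (rk P {x})"
    if z: "rk P {} = 0" and *: "0 \<le> rk P {x}" "rk P {x} \<le> int k"
  proof -
    define a where "a = nat (rk P {x})"
    have a: "rk P {x} = int a" "a \<le> k" using * by (auto simp: a_def)
    have "rk (natural_matroid k P) X = int (min (card X) a)" if "X \<subseteq> {x} \<times> {..<k}" for X
    proof -
      have *: "X - {x} \<times> {..<k} = {}" using that by blast
      show ?thesis
        using z by (simp add: rk_natural_matroid_Pow P Pow_insert a(1) min.commute *)
    qed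
    then have "binary (natural_matroid k P) \<longleftrightarrow> binary (uniform_matroid a ({x} \<times> {..<k}))"
      by (intro binary_cong) (auto simp: P uniform_matroid_def)
    also have "\<dots> \<longleftrightarrow> binary_rank k (rk P {x})"
      using a k by (subst binary_uniform_iff) (auto simp: binary_rank_def)
    finally show ?thesis .
  qed
  then show ?thesis
    using k unfolding in_P_U24_def poly by (auto simp: binary_rank_def)
qed

section \<open>Polymatroids on two elements\<close>

text \<open>
  The rank, in the natural matroid of a polymatroid with \<open>\<rho>(x) = a\<close>, \<open>\<rho>(y) = b\<close>, \<open>\<rho>(xy) = c\<close>, of a set
  with \<open>p\<close> elements above \<open>x\<close> and \<open>q\<close> elements above \<open>y\<close>: the four terms of the minimum belong to the
  subsets \<open>{}\<close>, \<open>{x}\<close>, \<open>{y}\<close> and \<open>{x, y}\<close> of the ground set.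
\<close>

definition pair_rank :: "int \<Rightarrow> int \<Rightarrow> int \<Rightarrow> nat \<Rightarrow> nat \<Rightarrow> int" where
  "pair_rank a b c p q = min (min (int p + int q) (a + int q)) (min (b + int p) c)"

locale two_element =
  fixes k :: nat and P :: "'a polymatroid" and x y :: 'a and a b c :: int
  assumes ground: "ground P = {x, y}" and neq: "x \<noteq> y"
    and a: "a = rk P {x}" and b: "b = rk P {y}" and c: "c = rk P {x, y}"
begin

lemma subsets: "A \<subseteq> {x, y} \<longleftrightarrow> A \<in> {{}, {x}, {y}, {x, y}}"
  by auto

lemma k_polymatroid_iff:
  "k_polymatroid k P \<longleftrightarrow>
    rk P {} = 0 \<and> 0 \<le> a \<and> a \<le> int k \<and> 0 \<le> b \<and> b \<le> int k \<and> a \<le> c \<and> b \<le> c \<and> c \<le> a + b"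
  (is "?L \<longleftrightarrow> ?R")
proof
  assume ?L
  then have mono: "\<And>A B. A \<subseteq> B \<Longrightarrow> B \<subseteq> {x, y} \<Longrightarrow> rk P A \<le> rk P B"
    and sub: "\<And>A B. A \<subseteq> {x, y} \<Longrightarrow> B \<subseteq> {x, y} \<Longrightarrow> rk P (A \<inter> B) + rk P (A \<union> B) \<le> rk P A + rk P B"
    and z: "rk P {} = 0" and le: "a \<le> int k" "b \<le> int k"
    using a b by (auto simp: k_polymatroid_def polymatroid_def ground)
  have "{x} \<union> {y} = {x, y}" by auto
  then show ?R
    using mono[of "{}" "{x}"] mono[of "{}" "{y}"] mono[of "{x}" "{x, y}"] mono[of "{y}" "{x, y}"]
      sub[of "{x}" "{y}"] z le neq by (simp add: a b c)
next
  assume R: ?R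
  have [simp]: "insert y (insert x A) = insert x (insert y A)" for A by auto
  have "rk P A \<le> rk P B" if "A \<subseteq> B" "B \<subseteq> {x, y}" for A B
  proof -
    have "A \<in> {{}, {x}, {y}, {x, y}}" "B \<in> {{}, {x}, {y}, {x, y}}"
      using that subsets by (meson subset_trans)+
    then show ?thesis using that(1) R neq unfolding a b c by (elim insertE emptyE) simp_all
  qed
  moreover have "rk P (A \<inter> B) + rk P (A \<union> B) \<le> rk P A + rk P B"
    if "A \<subseteq> {x, y}" "B \<subseteq> {x, y}" for A B
  proof -
    have "A \<in> {{}, {x}, {y}, {x, y}}" "B \<in> {{}, {x}, {y}, {x, y}}"
      using that subsets by meson+
    then show ?thesis using R neq unfolding a b c by (elim insertE emptyE) simp_all
  qed
  ultimately show ?L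
    using R by (simp add: k_polymatroid_def polymatroid_def ground a b)
qed

text \<open>
  Only the four one-element minors matter, since a minor with empty ground set always belongs to the
  class. Deletion leaves the ranks \<open>a\<close> and \<open>b\<close>, contraction the ranks \<open>c - b\<close> and \<open>c - a\<close>.
\<close>

lemma proper_minors_iff:
  assumes k: "1 \<le> k" and z: "rk P {} = 0"
  shows "(\<forall>N. proper_minor N P \<longrightarrow> in_P_U24 k N) \<longleftrightarrow>
    binary_rank k a \<and> binary_rank k b \<and> binary_rank k (c - a) \<and> binary_rank k (c - b)" (is "?L \<longleftrightarrow> ?R")
proof -
  define N where "N = (\<lambda>X Y. contraction (deletion P X) Y)"
  have gN: "ground (N X Y) = {x, y} - X - Y" and rN: "rk (N X Y) Z = rk P (Y \<union> Z) - rk P Y" for X Y Z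
    by (auto simp: N_def contraction_def deletion_def ground)
  have swap: "{y, x} = {x, y}" by auto
  have iff: "in_P_U24 k (N {y} {}) \<longleftrightarrow> binary_rank k a"
       "in_P_U24 k (N {x} {}) \<longleftrightarrow> binary_rank k b"
       "in_P_U24 k (N {} {x}) \<longleftrightarrow> binary_rank k (c - a)"
       "in_P_U24 k (N {} {y}) \<longleftrightarrow> binary_rank k (c - b)"
    using neq z k
    by (subst in_P_U24_singleton_iff[of _ x] in_P_U24_singleton_iff[of _ y]; auto simp: gN rN a b c swap)+
  have minor: "proper_minor M P \<longleftrightarrow>
      (\<exists>X Y. X \<subseteq> {x, y} \<and> Y \<subseteq> {x, y} \<and> X \<inter> Y = {} \<and> X \<union> Y \<noteq> {} \<and> M = N X Y)" for M
    by (simp add: proper_minor_def ground N_def)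
  have full: "in_P_U24 k (N X Y)" if "X \<union> Y = {x, y}" for X Y
    using that by (intro in_P_U24_empty) (auto simp: gN rN)
  show ?thesis
  proof
    assume L: ?L
    have "proper_minor (N X Y) P"
      if "(X, Y) \<in> {({y}, {}), ({x}, {}), ({}, {x}), ({}, {y})}" for X Y
      unfolding minor by (rule exI[of _ X], rule exI[of _ Y]) (use that in auto)
    then show ?R unfolding iff[symmetric] using L by blast
  next
    assume ?R
    then have sgl: "in_P_U24 k (N {y} {})" "in_P_U24 k (N {x} {})"
       "in_P_U24 k (N {} {x})" "in_P_U24 k (N {} {y})" unfolding iff by auto
    show ?L
    proof (intro allI impI)
      fix M assume "proper_minor M P"
      then obtain X Y where XY: "X \<subseteq> {x, y}" "Y \<subseteq> {x, y}" "X \<inter> Y = {}" "X \<union> Y \<noteq> {}" "M = N X Y"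
        unfolding minor by (elim exE conjE)
      show "in_P_U24 k M"
      proof (cases "X \<union> Y = {x, y}")
        case True
        then show ?thesis using full XY(5) by simp
      next
        case False
        have "X \<in> {{}, {x}, {y}, {x, y}}" "Y \<in> {{}, {x}, {y}, {x, y}}"
          using XY subsets by meson+
        then show ?thesis using False XY(3,4,5) sgl by auto
      qed
    qed
  qed
qed

lemma rk_natural_matroid:
  assumes z: "rk P {} = 0" and X: "X \<subseteq> {x, y} \<times> {..<k}"
  shows "rk (natural_matroid k P) X = pair_rank a b c (card (X \<inter> {x} \<times> UNIV)) (card (X \<inter> {y} \<times> UNIV))"
proof -
  have fX: "finite X" by (rule finite_subset[OF X]) simp
  have "X = X \<inter> {x} \<times> UNIV \<union> X \<inter> {y} \<times> UNIV" using X by auto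
  moreover have "(X \<inter> {x} \<times> UNIV) \<inter> (X \<inter> {y} \<times> UNIV) = {}" using neq by auto
  ultimately have card: "card X = card (X \<inter> {x} \<times> UNIV) + card (X \<inter> {y} \<times> UNIV)"
    using fX by (metis card_Un_disjoint finite_Int)
  have diff: "X - {x} \<times> {..<k} = X \<inter> {y} \<times> UNIV" "X - {y} \<times> {..<k} = X \<inter> {x} \<times> UNIV"
    "X - {x, y} \<times> {..<k} = {}" using X neq by auto
  have "Pow {x, y} = {{}, {x}, {y}, {x, y}}" using subsets by blast
  then show ?thesis
    by (simp add: rk_natural_matroid_Pow ground z pair_rank_def a b c card diff min.assoc)
qed

text \<open>
  Because the rank depends only on the numbers of elements above \<open>x\<close> and \<open>y\<close>, a minor \<open>U\<^sub>2\<^sub>,\<^sub>4\<close> is described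
  by four numbers: contract \<open>p\<close> elements above \<open>x\<close> and \<open>q\<close> above \<open>y\<close>, and keep \<open>i\<close> further elements
  above \<open>x\<close> and \<open>j\<close> above \<open>y\<close>.
\<close>

lemma not_binary_natural_matroid:
  assumes z: "rk P {} = 0" and le: "p + i \<le> k" "q + j \<le> k" "i + j = 4"
    and r: "\<And>s t. s \<le> i \<Longrightarrow> t \<le> j \<Longrightarrow> pair_rank a b c (p + s) (q + t) = R + int (min (s + t) 2)"
  shows "\<not> binary (natural_matroid k P)"
proof -
  define C where "C = {x} \<times> {..<p} \<union> {y} \<times> {..<q}"
  define T where "T = {x} \<times> {p..<p + i} \<union> {y} \<times> {q..<q + j}"
  have C: "C \<subseteq> {x, y} \<times> {..<k}" and T: "T \<subseteq> {x, y} \<times> {..<k}"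
    using le by (auto simp: C_def T_def)
  have fT: "finite T" by (simp add: T_def)
  have cT: "card T = 4"
    unfolding T_def using neq le(3) by (subst card_Un_disjoint) auto
  show ?thesis
  proof (rule not_binary_if_four_point_line[of C _ T R])
    fix D assume D: "D \<subseteq> T"
    define Dx Dy where "Dx = D \<inter> {x} \<times> UNIV" and "Dy = D \<inter> {y} \<times> UNIV"
    have fD: "finite Dx" "finite Dy" using finite_subset[OF D fT] by (simp_all add: Dx_def Dy_def)
    have "D = Dx \<union> Dy" "Dx \<inter> Dy = {}" using D neq by (auto simp: Dx_def Dy_def T_def)
    then have cD: "card D = card Dx + card Dy" using fD by (metis card_Un_disjoint)
    have sub: "Dx \<subseteq> {x} \<times> {p..<p + i}" "Dy \<subseteq> {y} \<times> {q..<q + j}"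
      using D neq by (auto simp: Dx_def Dy_def T_def)
    have le: "card Dx \<le> i" "card Dy \<le> j"
      using card_mono[OF _ sub(1)] card_mono[OF _ sub(2)] by (simp_all add: card_cartesian_product)
    have eq: "(C \<union> D) \<inter> {x} \<times> UNIV = {x} \<times> {..<p} \<union> Dx" "(C \<union> D) \<inter> {y} \<times> UNIV = {y} \<times> {..<q} \<union> Dy"
      using neq by (auto simp: C_def Dx_def Dy_def)
    have cx: "card ({x} \<times> {..<p} \<union> Dx) = p + card Dx"
      using fD sub by (subst card_Un_disjoint) (auto simp: card_cartesian_product)
    have cy: "card ({y} \<times> {..<q} \<union> Dy) = q + card Dy"
      using fD sub by (subst card_Un_disjoint) (auto simp: card_cartesian_product)
    have "C \<union> D \<subseteq> {x, y} \<times> {..<k}" using C D T by blast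
    from rk_natural_matroid[OF z this] show "rk (natural_matroid k P) (C \<union> D) = R + int (min (card D) 2)"
      unfolding eq cx cy r[OF le] cD .
  qed (use C T cT in \<open>auto simp: ground C_def\<close>)
qed

end

context two_element
begin

text \<open>
  There is no interaction between \<open>x\<close> and \<open>y\<close> if \<open>c = a + b\<close>: the natural matroid is the direct sum of two
  uniform matroids.
\<close>

lemma binary_if_direct_sum:
  assumes z: "rk P {} = 0" and k: "1 \<le> k" and e: "binary_rank k a" "binary_rank k b" and s: "c = a + b"
  shows "binary (natural_matroid k P)"
proof -
  let ?M = "uniform_matroid (nat a) ({x} \<times> {..<k})" and ?N = "uniform_matroid (nat b) ({y} \<times> {..<k})"
  have split: "pair_rank a b c p q = min (int p) a + min (int q) b" for p q
    unfolding pair_rank_def s by linarith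
  have ab: "0 \<le> a" "0 \<le> b" using e k by (auto simp: binary_rank_def)
  show ?thesis
    unfolding binary_def
  proof (rule representable_direct_sum[of _ ?M ?N])
    fix X assume "X \<subseteq> ground (natural_matroid k P)"
    then have X: "X \<subseteq> {x, y} \<times> {..<k}" by (simp add: ground)
    then have eq: "X \<inter> {x} \<times> {..<k} = X \<inter> {x} \<times> UNIV" "X \<inter> {y} \<times> {..<k} = X \<inter> {y} \<times> UNIV" by auto
    show "rk (natural_matroid k P) X = rk ?M (X \<inter> ground ?M) + rk ?N (X \<inter> ground ?N)"
      unfolding rk_natural_matroid[OF z X]
      using ab by (simp add: uniform_matroid_def eq split)
  qed (use neq e k in \<open>auto simp: ground uniform_matroid_def binary_rank_def
        intro!: representable_uniform[unfolded uniform_matroid_def]\<close>)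
qed

text \<open>
  All elements of the natural matroid are parallel.
\<close>

lemma binary_if_rank_one:
  assumes z: "rk P {} = 0" and abc: "a = 1" "b = 1" "c = 1"
  shows "binary (natural_matroid k P)"
  unfolding binary_def
proof (rule representable_circuit_image[of "\<lambda>_. 0" _ 1])
  fix X assume "X \<subseteq> ground (natural_matroid k P)"
  then have X: "X \<subseteq> {x, y} \<times> {..<k}" by (simp add: ground)
  have fX: "finite X" by (rule finite_subset[OF X]) simp
  have "X = {} \<longleftrightarrow> card (X \<inter> {x} \<times> UNIV) = 0 \<and> card (X \<inter> {y} \<times> UNIV) = 0"
    using X fX by auto
  then show "rk (natural_matroid k P) X = int (min (card ((\<lambda>_. 0::nat) ` X)) 1)"
    unfolding rk_natural_matroid[OF z X] pair_rank_def abc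
    by (cases "X = {}") (auto simp: image_constant_conv)
qed auto

text \<open>
  The natural matroid is the circuit on \<open>k + 1\<close> elements with one element replaced by \<open>k\<close> parallel ones:
  the elements above \<open>y\<close> form a basis, and every element above \<open>x\<close> completes
  this basis to a circuit.
\<close>

lemma binary_if_parallel_class_in_circuit:
  assumes z: "rk P {} = 0" and abc: "a = 1" "b = int k" "c = int k"
  shows "binary (natural_matroid k P)"
  unfolding binary_def
proof (rule representable_circuit_image[of "\<lambda>(u, i). if u = x then k else i" _ k])
  let ?\<phi> = "\<lambda>(u, i). if u = x then k else i"
  fix X assume "X \<subseteq> ground (natural_matroid k P)"
  then have X: "X \<subseteq> {x, y} \<times> {..<k}" by (simp add: ground)
  have fX: "finite X" by (rule finite_subset[OF X]) simp
  define Q where "Q = X \<inter> {y} \<times> UNIV"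
  have "snd ` Q \<subseteq> {..<k}" and inj: "inj_on snd Q" using X by (auto simp: Q_def inj_on_def)
  then have Qk: "card Q \<le> k" "k \<notin> snd ` Q" "card (snd ` Q) = card Q"
    using card_mono[of "{..<k}" "snd ` Q"] by (auto simp: card_image)
  have "?\<phi> ` X = (if X \<inter> {x} \<times> UNIV = {} then {} else {k}) \<union> snd ` Q"
    using X neq by (force simp: Q_def image_iff)
  then have "card (?\<phi> ` X) = min 1 (card (X \<inter> {x} \<times> UNIV)) + card Q"
    using Qk fX by (auto simp: Q_def Suc_le_eq card_gt_0_iff min_absorb1)
  then show "rk (natural_matroid k P) X = int (min (card (?\<phi> ` X)) k)"
    unfolding rk_natural_matroid[OF z X] pair_rank_def abc
    using Qk(1) by (simp add: Q_def min_def)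
qed (auto simp: ground)

text \<open>
  The natural matroid is a circuit: all \<open>2 k\<close> elements together satisfy the only dependency.
\<close>

lemma binary_if_circuit:
  assumes z: "rk P {} = 0" and k: "1 \<le> k" and abc: "a = int k" "b = int k" "c = 2 * int k - 1"
  shows "binary (natural_matroid k P)"
  unfolding binary_def
proof (rule representable_circuit_image[of "\<lambda>(u, i). if u = x then i else k + i" _ "2 * k - 1"])
  let ?\<phi> = "\<lambda>(u, i). if u = x then i else k + i"
  fix X assume "X \<subseteq> ground (natural_matroid k P)"
  then have X: "X \<subseteq> {x, y} \<times> {..<k}" by (simp add: ground)
  have fX: "finite X" by (rule finite_subset[OF X]) simp
  have inj: "inj_on ?\<phi> ({x, y} \<times> {..<k})"
    using neq by (auto simp: inj_on_def)
  have "card (X \<inter> {u} \<times> UNIV) \<le> k" for u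
    using card_mono[of "{u} \<times> {..<k}" "X \<inter> {u} \<times> UNIV"] X by (auto simp: card_cartesian_product)
  note le = this[of x] this[of y]
  have "card X = card (X \<inter> {x} \<times> UNIV \<union> X \<inter> {y} \<times> UNIV)"
    using X by (intro arg_cong[of _ _ card]) auto
  also have "\<dots> = card (X \<inter> {x} \<times> UNIV) + card (X \<inter> {y} \<times> UNIV)"
    using fX neq by (intro card_Un_disjoint) auto
  finally have "card (?\<phi> ` X) = card (X \<inter> {x} \<times> UNIV) + card (X \<inter> {y} \<times> UNIV)"
    using card_image[OF inj_on_subset[OF inj X]] by simp
  then show "rk (natural_matroid k P) X = int (min (card (?\<phi> ` X)) (2 * k - 1))"
    unfolding rk_natural_matroid[OF z X] pair_rank_def abc
    using le k by (auto simp: min_def of_nat_diff)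
qed (use k in \<open>auto simp: ground\<close>)

end

text \<open>
  The triples \<open>(\<rho>(x), \<rho>(y), \<rho>(xy))\<close> of the excluded minors, with the smaller singleton rank first.
\<close>

definition excluded_triples :: "nat \<Rightarrow> (int \<times> int \<times> int) list" where
  "excluded_triples k =
     (let l = int k in
      [(l - 1, l - 1, l - 1), (l - 1, l - 1, l), (l, l, l), (l, l, l + 1), (l - 1, l, l)]
      @ (if k = 3 then [(1, 2, 2), (2, 3, 4)] else []))"

context two_element
begin

text \<open>
  In each case the contracted set has \<open>c - 2\<close> elements, and together with any two of the four
  further elements it has at most \<open>a\<close> elements above \<open>x\<close> and at most \<open>b\<close> above \<open>y\<close>. All these
  sets are therefore independent, and those of size \<open>c\<close> have full rank.
\<close>

lemma not_binary_if_excluded_triple: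
  assumes k: "3 \<le> k" and z: "rk P {} = 0" and t: "(a, b, c) \<in> set (excluded_triples k)"
  shows "\<not> binary (natural_matroid k P)"
proof -
  (* Avoids truncated subtraction in the numbers of contracted elements. *)
  obtain m where m: "k = m + 3" using k by (metis le_add_diff_inverse2)
  note nb = not_binary_natural_matroid[OF z]
  consider "a = int k - 1" "b = int k - 1" "c = int k - 1" | "a = int k - 1" "b = int k - 1" "c = int k"
    | "a = int k" "b = int k" "c = int k" | "a = int k" "b = int k" "c = int k + 1"
    | "a = int k - 1" "b = int k" "c = int k"
    | "k = 3" "a = 1" "b = 2" "c = 2" | "k = 3" "a = 2" "b = 3" "c = 4"
    using t by (auto simp: excluded_triples_def Let_def split: if_splits)
  then show ?thesis
  proof cases
    case 1
    show ?thesis by (rule nb[of m 2 0 2 "int m"]) (auto simp: 1 m pair_rank_def)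
  next
    case 2
    show ?thesis by (rule nb[of "m + 1" 1 0 3 "int m + 1"]) (auto simp: 2 m pair_rank_def)
  next
    case 3
    show ?thesis by (rule nb[of "m + 1" 2 0 2 "int m + 1"]) (auto simp: 3 m pair_rank_def)
  next
    case 4
    show ?thesis by (rule nb[of "m + 1" 2 1 2 "int m + 2"]) (auto simp: 4 m pair_rank_def)
  next
    case 5
    show ?thesis by (rule nb[of "m + 1" 1 0 3 "int m + 1"]) (auto simp: 5 m pair_rank_def)
  next
    case 6
    show ?thesis by (rule nb[of 0 1 0 3 0]) (auto simp: 6 pair_rank_def)
  next
    case 7
    show ?thesis by (rule nb[of 0 3 2 1 2]) (auto simp: 7 pair_rank_def)
  qed
qed

text \<open>
  Besides the excluded minors, only four kinds of triples have all one-element minors in the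
  class, and these four turn out to be binary. The sporadic triples for \<open>k = 3\<close> come from the
  coincidence \<open>k - 1 = 2\<close>: each has a one-element minor of rank two, which for larger \<open>k\<close> is
  itself not binary.
\<close>

lemma minor_ranks_cases:
  assumes k: "3 \<le> k" and "a \<le> b" "b \<le> int k" "b \<le> c" "c \<le> a + b"
    and e: "binary_rank k a" "binary_rank k b" "binary_rank k (c - a)" "binary_rank k (c - b)"
  shows "(a, b, c) \<in> set (excluded_triples k) \<or> c = a + b \<or> (a = 1 \<and> b = 1 \<and> c = 1)
    \<or> (a = 1 \<and> b = int k \<and> c = int k) \<or> (a = int k \<and> b = int k \<and> c = 2 * int k - 1)"
proof -
  define l where "l = int k"
  have l: "3 \<le> l" using k by (simp add: l_def)
  have mem: "(a, b, c) \<in> set (excluded_triples k) \<longleftrightarrow>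
     (a = l - 1 \<and> b = l - 1 \<and> c = l - 1) \<or> (a = l - 1 \<and> b = l - 1 \<and> c = l) \<or>
     (a = l \<and> b = l \<and> c = l) \<or> (a = l \<and> b = l \<and> c = l + 1) \<or> (a = l - 1 \<and> b = l \<and> c = l) \<or>
     l = 3 \<and> (a = 1 \<and> b = 2 \<and> c = 2 \<or> a = 2 \<and> b = 3 \<and> c = 4)"
    by (auto simp: excluded_triples_def Let_def l_def)
  have ab: "a = 0 \<or> a = 1 \<or> a = l - 1 \<or> a = l" "b = 0 \<or> b = 1 \<or> b = l - 1 \<or> b = l"
    and cs: "c - a = 0 \<or> c - a = 1 \<or> c - a = l - 1 \<or> c - a = l"
      "c - b = 0 \<or> c - b = 1 \<or> c - b = l - 1 \<or> c - b = l"
    using e by (auto simp: binary_rank_def l_def)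
  have "a \<le> b" "b \<le> l" "b \<le> c" "c \<le> a + b" using assms(2-5) by (simp_all add: l_def)
  with ab cs l show ?thesis
    unfolding mem l_def[symmetric] by (smt (verit))
qed

lemma excluded_minor_iff:
  assumes k: "3 \<le> k" and le: "a \<le> b"
  shows "excluded_minor k P \<longleftrightarrow> rk P {} = 0 \<and> (a, b, c) \<in> set (excluded_triples k)"
proof
  assume ex: "excluded_minor k P"
  then have poly: "k_polymatroid k P" and nb: "\<not> binary (natural_matroid k P)"
    by (auto simp: excluded_minor_def in_P_U24_def)
  from poly have z: "rk P {} = 0" and bounds: "b \<le> int k" "b \<le> c" "c \<le> a + b"
    unfolding k_polymatroid_iff by auto
  have e: "binary_rank k a" "binary_rank k b" "binary_rank k (c - a)" "binary_rank k (c - b)"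
    using ex proper_minors_iff[OF _ z] k by (auto simp: excluded_minor_def)
  show "rk P {} = 0 \<and> (a, b, c) \<in> set (excluded_triples k)"
    using minor_ranks_cases[OF k le bounds e] nb z k e binary_if_direct_sum binary_if_rank_one
      binary_if_parallel_class_in_circuit binary_if_circuit by auto
next
  assume R: "rk P {} = 0 \<and> (a, b, c) \<in> set (excluded_triples k)"
  then have "k_polymatroid k P"
    using k unfolding k_polymatroid_iff
    by (auto simp: excluded_triples_def Let_def split: if_splits)
  moreover have "binary_rank k a \<and> binary_rank k b \<and> binary_rank k (c - a) \<and> binary_rank k (c - b)"
    using R k by (auto simp: excluded_triples_def Let_def binary_rank_def split: if_splits)
  ultimately show "excluded_minor k P"
    using R not_binary_if_excluded_triple[OF k] proper_minors_iff k
    by (auto simp: excluded_minor_def in_P_U24_def)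
qed

end

section \<open>Isomorphism classes and duals\<close>

lemma poly2_rk:
  assumes "e \<noteq> f"
  shows "rk (poly2 e f a b c) {} = 0" "rk (poly2 e f a b c) {e} = a" "rk (poly2 e f a b c) {f} = b"
    "rk (poly2 e f a b c) {e, f} = c" "ground (poly2 e f a b c) = {e, f}"
  using assms by (auto simp: poly2_def)

lemma iso_poly2I:
  assumes P: "ground P = {x, y}" "x \<noteq> y" and "e \<noteq> f"
    and "rk P {} = 0" "rk P {x} = a" "rk P {y} = b" "rk P {x, y} = c"
  shows "P \<simeq> poly2 e f a b c"
  unfolding poly_iso_def
proof (intro exI[of _ "\<lambda>u. if u = x then e else f"] conjI allI impI)
  show "bij_betw (\<lambda>u. if u = x then e else f) (ground P) (ground (poly2 e f a b c))"
    using assms(1-3) by (auto simp: bij_betw_def inj_on_def poly2_def)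
  fix A assume "A \<subseteq> ground P"
  then have "A \<in> {{}, {x}, {y}, {x, y}}" using P by auto
  moreover have "{f, e} = {e, f}" by auto
  ultimately show "rk (poly2 e f a b c) ((\<lambda>u. if u = x then e else f) ` A) = rk P A"
    using assms poly2_rk[OF assms(3)] by auto
qed

text \<open>
  An isomorphism either fixes or exchanges \<open>e\<close> and \<open>f\<close>, so the pair of singleton ranks, once
  sorted, is an isomorphism invariant.
\<close>

lemma poly2_isoD:
  assumes ne: "e \<noteq> f" and le: "a \<le> b" "a' \<le> b'" and iso: "poly2 e f a b c \<simeq> poly2 e f a' b' c'"
  shows "(a, b, c) = (a', b', c')"
proof -
  obtain h where h: "bij_betw h {e, f} {e, f}"
    and r: "\<And>A. A \<subseteq> {e, f} \<Longrightarrow> rk (poly2 e f a' b' c') (h ` A) = rk (poly2 e f a b c) A"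
    using iso by (auto simp: poly_iso_def poly2_rk[OF ne])
  have "h ` {e, f} = {e, f}" using h by (simp add: bij_betw_def)
  then have c: "c' = c" using r[of "{e, f}"] by (simp add: poly2_rk[OF ne])
  have "h e = e \<and> h f = f \<or> h e = f \<and> h f = e"
    using h ne by (auto simp: bij_betw_def inj_on_def)
  then show ?thesis
    using r[of "{e}"] r[of "{f}"] c le by (elim disjE conjE) (simp_all add: poly2_rk[OF ne])
qed

text \<open>
  Two-element polymatroids up to isomorphism correspond to triples whose first two entries are sorted. The condition
  on \<open>C\<close> is required only when \<open>x\<close> has the smaller rank, since the two elements can be named in
  either order.
\<close>

lemma exactly_up_to_iso_poly2:
  assumes ne: "e \<noteq> f" and "distinct T" and T: "\<And>a b c. (a, b, c) \<in> set T \<Longrightarrow> a \<le> b"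
    and C: "\<And>P x y. ground P = {x, y} \<Longrightarrow> x \<noteq> y \<Longrightarrow> rk P {x} \<le> rk P {y} \<Longrightarrow>
       C P \<longleftrightarrow> rk P {} = 0 \<and> (rk P {x}, rk P {y}, rk P {x, y}) \<in> set T"
  shows "exactly_up_to_iso (\<lambda>P. card (ground P) = 2 \<and> C P) (map (\<lambda>(a, b, c). poly2 e f a b c) T)"
  unfolding exactly_up_to_iso_def
proof (intro conjI ballI allI impI)
  fix Q assume "Q \<in> set (map (\<lambda>(a, b, c). poly2 e f a b c) T)"
  then obtain a b c where abc: "(a, b, c) \<in> set T" and Q: "Q = poly2 e f a b c" by auto
  show "card (ground Q) = 2" using ne by (simp add: Q poly2_def)
  show "C Q" using C[of Q e f] abc T[OF abc] poly2_rk[OF ne] ne by (simp add: Q)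
next
  fix P :: "'a polymatroid" assume P: "card (ground P) = 2 \<and> C P"
  then obtain x y where xy: "ground P = {x, y}" "x \<noteq> y" by (auto simp: card_2_iff)
  have "\<exists>x y. ground P = {x, y} \<and> x \<noteq> y \<and> rk P {x} \<le> rk P {y}"
    using xy by (metis insert_commute linear)
  then obtain x y where xy: "ground P = {x, y}" "x \<noteq> y" "rk P {x} \<le> rk P {y}" by blast
  have "rk P {} = 0" "(rk P {x}, rk P {y}, rk P {x, y}) \<in> set T" using C[OF xy] P by auto
  then show "\<exists>Q\<in>set (map (\<lambda>(a, b, c). poly2 e f a b c) T). P \<simeq> Q"
    using iso_poly2I[OF xy(1,2) ne] by (force simp: image_iff)
next
  fix i j assume ij: "i < length (map (\<lambda>(a, b, c). poly2 e f a b c) T)"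
    "j < length (map (\<lambda>(a, b, c). poly2 e f a b c) T)" "i \<noteq> j"
  obtain a b c where i: "T ! i = (a, b, c)" by (cases "T ! i") auto
  obtain a' b' c' where j: "T ! j = (a', b', c')" by (cases "T ! j") auto
  have "a \<le> b" "a' \<le> b'" using T i j ij by (metis length_map nth_mem)+
  moreover have "(a, b, c) \<noteq> (a', b', c')"
    using assms(2) ij i j by (metis length_map nth_eq_iff_index_eq)
  ultimately show "\<not> map (\<lambda>(a, b, c). poly2 e f a b c) T ! i \<simeq> map (\<lambda>(a, b, c). poly2 e f a b c) T ! j"
    using poly2_isoD[OF ne] ij i j by fastforce
qed

lemma excluded_minors_exactly:
  assumes "e \<noteq> f" "3 \<le> k"
  shows "exactly_up_to_iso (\<lambda>P. card (ground P) = 2 \<and> excluded_minor k P)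
    (map (\<lambda>(a, b, c). poly2 e f a b c) (excluded_triples k))"
proof (rule exactly_up_to_iso_poly2[OF assms(1)])
  show "distinct (excluded_triples k)"
    using assms(2) by (auto simp: excluded_triples_def Let_def)
  show "a \<le> b" if "(a, b, c) \<in> set (excluded_triples k)" for a b c
    using that by (auto simp: excluded_triples_def Let_def split: if_splits)
  show "excluded_minor k P \<longleftrightarrow>
      rk P {} = 0 \<and> (rk P {x}, rk P {y}, rk P {x, y}) \<in> set (excluded_triples k)"
    if "ground P = {x, y}" "x \<noteq> y" "rk P {x} \<le> rk P {y}" for P :: "'a polymatroid" and x y
  proof -
    interpret two_element k P x y "rk P {x}" "rk P {y}" "rk P {x, y}"
      using that by unfold_locales auto
    show ?thesis using excluded_minor_iff assms(2) that(3) .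
  qed
qed

lemma k_dual_poly2:
  assumes "e \<noteq> f"
  shows "ground (k_dual k (poly2 e f a b c)) = {e, f}" "rk (k_dual k (poly2 e f a b c)) {} = 0"
    "rk (k_dual k (poly2 e f a b c)) {e} = int k + b - c"
    "rk (k_dual k (poly2 e f a b c)) {f} = int k + a - c"
    "rk (k_dual k (poly2 e f a b c)) {e, f} = 2 * int k - c"
proof -
  have "{e, f} - {e} = {f}" "{e, f} - {f} = {e}" using assms by auto
  then show "ground (k_dual k (poly2 e f a b c)) = {e, f}" "rk (k_dual k (poly2 e f a b c)) {} = 0"
    "rk (k_dual k (poly2 e f a b c)) {e} = int k + b - c"
    "rk (k_dual k (poly2 e f a b c)) {f} = int k + a - c"
    "rk (k_dual k (poly2 e f a b c)) {e, f} = 2 * int k - c"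
    using assms poly2_rk[OF assms, of a b c] by (simp_all add: k_dual_def)
qed

text \<open>
  Duality adds \<open>k - c\<close> to both singleton ranks and exchanges them. The isomorphism may exchange
  them back, whence the two admissible pairs.
\<close>

lemma k_dual_poly2_iso:
  assumes "e \<noteq> f" and "{(a', b'), (b', a')} \<inter> {(int k + b - c, int k + a - c)} \<noteq> {}"
    and "c' = 2 * int k - c"
  shows "k_dual k (poly2 e f a b c) \<simeq> poly2 e f a' b' c'"
proof -
  have "{f, e} = {e, f}" by auto
  then show ?thesis
    using assms k_dual_poly2[OF assms(1), of k a b c]
      iso_poly2I[of "k_dual k (poly2 e f a b c)" e f e f a' b' c']
      iso_poly2I[of "k_dual k (poly2 e f a b c)" f e e f a' b' c'] by auto
qed

text \<open>
  If \<open>c = k\<close>, duality only exchanges the two singleton ranks.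
\<close>

lemma self_k_dual_poly2:
  assumes "e \<noteq> f"
  shows "self_k_dual k (poly2 e f a b (int k))" (is "self_k_dual k ?P")
  unfolding self_k_dual_def poly_iso_def
proof (intro exI[of _ "\<lambda>u. if u = e then f else e"] conjI allI impI)
  show "bij_betw (\<lambda>u. if u = e then f else e) (ground ?P)
      (ground (k_dual k ?P))"
    using assms by (auto simp: bij_betw_def inj_on_def poly2_rk k_dual_poly2)
  fix A assume "A \<subseteq> ground ?P"
  then have "A \<in> {{}, {e}, {f}, {e, f}}" using poly2_rk(5)[OF assms(1)] by auto
  moreover have "{f, e} = {e, f}" by auto
  ultimately show "rk (k_dual k ?P) ((\<lambda>u. if u = e then f else e) ` A)
      = rk ?P A"
    using assms by (auto simp: poly2_rk k_dual_poly2)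
qed

lemma identically_self_k_dual_poly2:
  assumes "e \<noteq> f"
  shows "identically_self_k_dual k (poly2 e f a a (int k))"
  unfolding identically_self_k_dual_def
proof (intro allI impI)
  fix A assume "A \<subseteq> ground (poly2 e f a a (int k))"
  then have "A \<in> {{}, {e}, {f}, {e, f}}" using poly2_rk(5)[OF assms(1)] by auto
  then show "rk (poly2 e f a a (int k)) A = rk (k_dual k (poly2 e f a a (int k))) A"
    using assms by (auto simp: poly2_rk k_dual_poly2)
qed

theorem theorem4p0p1:
  fixes e f :: 'a and k :: nat
  assumes "e \<noteq> f"
  shows
    "(4 \<le> k \<longrightarrow>
        exactly_up_to_iso (\<lambda>P. card (ground P) = 2 \<and> excluded_minor k P)
          [Ex_alpha k (int k - 1) e f,
           Ex_alpha k (int k) e f,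
           Ex_beta k (int k) e f,
           Ex_beta k (int k + 1) e f,
           Ex_epsilon k (int k) e f] \<and>
        k_dual k (Ex_alpha k (int k - 1) e f) \<simeq> Ex_beta k (int k + 1) e f \<and>
        identically_self_k_dual k (Ex_alpha k (int k) e f) \<and>
        identically_self_k_dual k (Ex_beta k (int k) e f) \<and>
        k_dual k (Ex_beta k (int k + 1) e f) \<simeq> Ex_alpha k (int k - 1) e f \<and>
        self_k_dual k (Ex_epsilon k (int k) e f))
     \<and>
     (exactly_up_to_iso (\<lambda>P. card (ground P) = 2 \<and> excluded_minor 3 P)
          [Ex_alpha 3 2 e f,
           Ex_alpha 3 3 e f,
           Ex_beta 3 3 e f,
           Ex_beta 3 4 e f,
           Ex_epsilon 3 3 e f,
           Ex_gamma 2 e f,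
           Ex_epsilon 3 4 e f] \<and>
        k_dual 3 (Ex_alpha 3 2 e f) \<simeq> Ex_beta 3 4 e f \<and>
        identically_self_k_dual 3 (Ex_alpha 3 3 e f) \<and>
        identically_self_k_dual 3 (Ex_beta 3 3 e f) \<and>
        k_dual 3 (Ex_beta 3 4 e f) \<simeq> Ex_alpha 3 2 e f \<and>
        self_k_dual 3 (Ex_epsilon 3 3 e f) \<and>
        k_dual 3 (Ex_gamma 2 e f) \<simeq> Ex_epsilon 3 4 e f \<and>
        k_dual 3 (Ex_epsilon 3 4 e f) \<simeq> Ex_gamma 2 e f)"
proof -
  note ex = excluded_minors_exactly[OF assms, of k] excluded_minors_exactly[OF assms, of 3]
  note defs = Ex_alpha_def Ex_beta_def Ex_epsilon_def Ex_gamma_def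
  note duals = k_dual_poly2_iso[OF assms] identically_self_k_dual_poly2[OF assms]
    self_k_dual_poly2[OF assms]
  note duals3 = identically_self_k_dual_poly2[OF assms, where k = 3]
    self_k_dual_poly2[OF assms, where k = 3]
  have "exactly_up_to_iso (\<lambda>P. card (ground P) = 2 \<and> excluded_minor k P)
      [Ex_alpha k (int k - 1) e f, Ex_alpha k (int k) e f, Ex_beta k (int k) e f,
       Ex_beta k (int k + 1) e f, Ex_epsilon k (int k) e f]" if "4 \<le> k"
    using ex(1) that by (simp add: defs excluded_triples_def Let_def)
  moreover have "exactly_up_to_iso (\<lambda>P. card (ground P) = 2 \<and> excluded_minor 3 P)
      [Ex_alpha 3 2 e f, Ex_alpha 3 3 e f, Ex_beta 3 3 e f, Ex_beta 3 4 e f,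
       Ex_epsilon 3 3 e f, Ex_gamma 2 e f, Ex_epsilon 3 4 e f]"
    using ex(2) by (simp add: defs excluded_triples_def Let_def)
  (* The statements for k = 3 have the numeral 3 in place of int k, which blocks unification. *)
  ultimately show ?thesis
    using duals3 by (auto simp: defs intro!: duals)
qed

end
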